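(* Let $n\geqslant r\geqslant 3$ and $k\geqslant 3$ be integers, and let $H$ be the balanced complete $k$-partite $r$-uniform hypergraph with $n$ vertices in each class. If $k\equiv 0 \pmod 3$, the $3$-coloring (colors red, blue, green) minimizing the number of monochromatic edges of $H$ is: color all vertices of the first $k/3$ classes red, all vertices of the next $k/3$ classes blue, and all vertices of the last $k/3$ classes green. If $k\equiv 1\pmod 3$, the $3$-coloring minimizing the number of monochromatic edges of $H$ is: color all vertices of the first $\lfloor k/3\rfloor$ classes red, all vertices of the next $\lfloor k/3\rfloor$ classes blue, all vertices of the next $\lfloor k/3\rfloor$ classes green, and color the vertices of the last class so that the numbers of red, blue and green vertices in it are as equal as possible (i.e. pairwise differ by at most $1$). Moreover, in each case the minimizing coloring is unique up to a permutation of colors and classes.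
   Context: The balanced complete $k$-partite $r$-uniform hypergraph with $n$ vertices in each class has vertex set the disjoint union of $k$ classes $V_1,\dots,V_k$ with $|V_i|=n$, and its edges are all $r$-element subsets of $V_1\cup\dots\cup V_k$ that are not contained in a single class $V_i$ (an edge may contain several vertices of the same class). A $3$-coloring assigns to each vertex one of three colors (not required to be proper). An edge is monochromatic if all its vertices have the same color. Colorings having the same number of vertices of each color in each class are regarded as the same coloring. *)

theory Defs
  imports Main
begin

datatype color = Red | Blue | Green

text \<open>The vertex \<open>(i, j)\<close> is the \<open>j\<close>-th vertex of class \<open>i\<close>; the classes are
  indexed by \<open>0, \<dots>, k - 1\<close>.\<close>

definition vclass :: "nat \<Rightarrow> nat \<Rightarrow> (nat \<times> nat) set" where
  "vclass n i = {i} \<times> {..<n}"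

definition vertices :: "nat \<Rightarrow> nat \<Rightarrow> (nat \<times> nat) set" where
  "vertices k n = (\<Union>i<k. vclass n i)"

definition hedges :: "nat \<Rightarrow> nat \<Rightarrow> nat \<Rightarrow> (nat \<times> nat) set set" where
  "hedges k n r =
     {e. e \<subseteq> vertices k n \<and> card e = r \<and> \<not> (\<exists>i<k. e \<subseteq> vclass n i)}"

text \<open>A coloring is a function on all pairs, but only its values on
  \<open>vertices k n\<close> matter in the definitions below.\<close>

type_synonym coloring = "nat \<times> nat \<Rightarrow> color"

definition monochromatic :: "coloring \<Rightarrow> (nat \<times> nat) set \<Rightarrow> bool" where
  "monochromatic c e \<longleftrightarrow> (\<exists>x. \<forall>v\<in>e. c v = x)"

definition num_mono :: "nat \<Rightarrow> nat \<Rightarrow> nat \<Rightarrow> coloring \<Rightarrow> nat" where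
  "num_mono k n r c = card {e \<in> hedges k n r. monochromatic c e}"

definition minimizing :: "nat \<Rightarrow> nat \<Rightarrow> nat \<Rightarrow> coloring \<Rightarrow> bool" where
  "minimizing k n r c \<longleftrightarrow> (\<forall>c'. num_mono k n r c \<le> num_mono k n r c')"

definition color_count :: "nat \<Rightarrow> coloring \<Rightarrow> nat \<Rightarrow> color \<Rightarrow> nat" where
  "color_count n c i x = card {v \<in> vclass n i. c v = x}"

text \<open>Colorings with the same number of vertices of each color in each class are
  identified, so equality up to a permutation \<open>\<pi>\<close> of the colors and a permutation
  \<open>\<sigma>\<close> of the classes is a statement about color counts.\<close>

definition same_up_to_perm :: "nat \<Rightarrow> nat \<Rightarrow> coloring \<Rightarrow> coloring \<Rightarrow> bool" where
  "same_up_to_perm k n c c' \<longleftrightarrow>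
     (\<exists>\<pi> \<sigma>. bij \<pi> \<and> bij_betw \<sigma> {..<k} {..<k} \<and>
        (\<forall>i<k. \<forall>x. color_count n c' (\<sigma> i) (\<pi> x) = color_count n c i x))"

text \<open>The first \<open>m\<close> classes are red, the next \<open>m\<close> blue, and the next \<open>m\<close> green;
  nothing is required of any further class.\<close>

definition block_colored :: "nat \<Rightarrow> nat \<Rightarrow> coloring \<Rightarrow> bool" where
  "block_colored m n c \<longleftrightarrow>
     (\<forall>i\<in>{0..<m}. \<forall>v\<in>vclass n i. c v = Red) \<and>
     (\<forall>i\<in>{m..<2 * m}. \<forall>v\<in>vclass n i. c v = Blue) \<and>
     (\<forall>i\<in>{2 * m..<3 * m}. \<forall>v\<in>vclass n i. c v = Green)"

definition equitable_on_class :: "nat \<Rightarrow> coloring \<Rightarrow> nat \<Rightarrow> bool" where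
  "equitable_on_class n c i \<longleftrightarrow>
     (\<forall>x y. color_count n c i x \<le> color_count n c i y + 1)"

definition unique_minimizer ::
    "nat \<Rightarrow> nat \<Rightarrow> nat \<Rightarrow> (coloring \<Rightarrow> bool) \<Rightarrow> bool" where
  "unique_minimizer k n r P \<longleftrightarrow>
     (\<exists>c. P c) \<and>
     (\<forall>c. P c \<longrightarrow> minimizing k n r c \<and>
        (\<forall>c'. minimizing k n r c' \<longrightarrow> same_up_to_perm k n c' c))"

end

(* Let S x be the number of vertices of color x. Within color x the classes save
   \<Sum>i. (a i choose r) edges, where a i \<le> n and \<Sum>i. a i = S x, and by convexity this is
   largest when as many classes as possible are full. So the number of monochromatic edges is at
   least \<Sum>x. g (S x) with g s = (s choose r) - (s div n) * (n choose r) - (s mod n choose r).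
   The function g is convex, strictly so from n - 1 on, hence the sum is least exactly
   when the three numbers S x are as equal as possible. For k mod 3 \<in> {0, 1} both bounds are
   attained at the same time, and equality forces k div 3 full classes in each color. *)
theory Submission
  imports Defs "HOL-Combinatorics.Permutations"
begin

lemma UNIV_color: "(UNIV :: color set) = {Red, Blue, Green}"
  using color.exhaust by auto

lemma finite_UNIV_color: "finite (UNIV :: color set)"
  by (simp add: UNIV_color)

section \<open>Convexity of binomial coefficients\<close>

text \<open>By Pascal's rule, raising the top from \<open>b - 1\<close> to \<open>b\<close> adds
  \<open>b - 1 choose (j - 1)\<close>, which is positive because
  \<open>1 \<le> j \<le> b\<close>.\<close>

lemma choose_strict_mono:
  fixes a b j :: nat
  assumes "1 \<le> j" "j \<le> b" "a < b"
  shows "a choose j < b choose j"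
proof -
  obtain b' i where b: "b = Suc b'" and j: "j = Suc i"
    using assms by (metis Suc_le_D One_nat_def le_trans)
  have "a choose j \<le> b' choose j"
    using assms b by (intro binomial_right_mono) simp
  moreover have "b' choose i > 0" using assms b j by simp
  ultimately show ?thesis unfolding b j binomial_Suc_Suc by linarith
qed

text \<open>Convexity of \<open>\<lambda>s. s choose r\<close> in shifted form. By Pascal's rule
  each further unit of shift adds \<open>c + u choose (r - 1)\<close> on the left and the no smaller
  \<open>b + u choose (r - 1)\<close> on the right.\<close>

lemma choose_exchange_le:
  fixes b c u r :: nat
  assumes "1 \<le> r" "c \<le> b"
  shows "(c + u choose r) + (b choose r) \<le> (c choose r) + (b + u choose r)"
proof (induction u)
  case (Suc u)
  obtain q where r: "r = Suc q" using assms(1) by (cases r) auto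
  have "c + u choose q \<le> b + u choose q"
    using assms by (intro binomial_right_mono) simp
  then show ?case using Suc by (simp add: r)
qed simp

text \<open>The last unit of the shift alone gives strictness: with \<open>u = v + 1\<close>, its
  gain at \<open>b + v\<close> exceeds the gain at \<open>c + v\<close>, since
  \<open>1 \<le> r - 1 \<le> b + v\<close>.\<close>

lemma choose_exchange_less:
  fixes b c u r :: nat
  assumes "2 \<le> r" "c < b" "1 \<le> u" "r \<le> b + u"
  shows "(c + u choose r) + (b choose r) < (c choose r) + (b + u choose r)"
proof -
  obtain q where r: "r = Suc q" using assms(1) by (cases r) auto
  obtain v where u: "u = Suc v" using assms(3) by (cases u) auto
  have "c + v choose q < b + v choose q"
    using assms r u by (intro choose_strict_mono) auto
  moreover have "(c + v choose r) + (b choose r) \<le> (c choose r) + (b + v choose r)"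
    using assms by (intro choose_exchange_le) auto
  ultimately show ?thesis by (simp add: r u)
qed

text \<open>The largest value of \<open>\<Sum>i. a i choose r\<close> over parts \<open>a i \<le> n\<close> with sum \<open>s\<close>: fill
  as many parts as possible completely.\<close>

definition packed :: "nat \<Rightarrow> nat \<Rightarrow> nat \<Rightarrow> nat" where
  "packed n r s = (s div n) * (n choose r) + (s mod n choose r)"

text \<open>If the new part and the remainder \<open>p\<close> fit together below \<open>n\<close>,
  they merge; otherwise units move from \<open>p\<close> to the part until it is full. For
  \<open>a < n\<close> the second move strictly gains, so equality means that no further full part
  arises.\<close>

lemma packed_add:
  fixes n r a s :: nat
  assumes "2 \<le> r" "r \<le> n" "a \<le> n"
  shows "(a choose r) + packed n r s \<le> packed n r (a + s)"
    and "\<lbrakk>(a choose r) + packed n r s = packed n r (a + s); a < n\<rbrakk> \<Longrightarrow> (a + s) div n = s div n"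
proof -
  define q p where "q = s div n" and "p = s mod n"
  have n: "n > 0" using assms by simp
  have p: "p < n" and s: "s = q * n + p" using n by (simp_all add: p_def q_def)
  have ps: "packed n r s = q * (n choose r) + (p choose r)"
    by (simp add: packed_def q_def p_def)
  have divmod: "(q' * n + c) div n = q'" "(q' * n + c) mod n = c" if "c < n" for q' c
    using that by simp_all
  have *: "(a choose r) + packed n r s \<le> packed n r (a + s) \<and>
    ((a choose r) + packed n r s = packed n r (a + s) \<longrightarrow> a < n \<longrightarrow> (a + s) div n = s div n)"
  proof (cases "a + p < n")
    case True
    have "a + s = q * n + (a + p)" by (simp add: s)
    then have as: "(a + s) div n = q" "(a + s) mod n = a + p"
      using divmod[OF True, of q] by (simp_all only:)
    \<comment> \<open>The exchange inequality with smaller argument 0 is superadditivity, as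
      \<open>0 choose r\<close> vanishes.\<close>
    have "(a choose r) + (p choose r) \<le> a + p choose r"
      using choose_exchange_le[of r 0 p a] assms by (simp add: binomial_eq_0 add.commute)
    then show ?thesis using as ps q_def by (simp add: packed_def)
  next
    case False
    \<comment> \<open>What is left of \<open>p\<close> after \<open>n - a\<close> units have filled
      the part: the pair \<open>(a, p)\<close> is exchanged for \<open>(n, c)\<close>.\<close>
    define c where "c = a + p - n"
    have "a + s = (q + 1) * n + c" "c < n" using False p assms by (auto simp: s c_def)
    then have as: "(a + s) div n = q + 1" "(a + s) mod n = c"
      using divmod[of c "q + 1"] by (simp_all only:)
    then have pas: "packed n r (a + s) = (n choose r) + q * (n choose r) + (c choose r)"
      by (simp add: packed_def)
    have eqs: "c + (n - a) = p" "a + (n - a) = n" "c \<le> a"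
      using False p assms by (auto simp: c_def)
    have le: "(p choose r) + (a choose r) \<le> (c choose r) + (n choose r)"
      using choose_exchange_le[of r c a "n - a"] assms eqs by simp
    have "(p choose r) + (a choose r) < (c choose r) + (n choose r)" if "a < n"
      using choose_exchange_less[of r c a "n - a"] assms eqs that p by (simp add: c_def)
    then show ?thesis using le by (auto simp: ps pas)
  qed
  show "(a choose r) + packed n r s \<le> packed n r (a + s)" using * by blast
  show "\<lbrakk>(a choose r) + packed n r s = packed n r (a + s); a < n\<rbrakk> \<Longrightarrow> (a + s) div n = s div n"
    using * by blast
qed

text \<open>The parts are added one at a time. Equality at the end forces equality at every step;
  then a full part raises the quotient by one and any other part leaves it unchanged.\<close>

lemma packed_sum:
  fixes a :: "'a \<Rightarrow> nat"
  assumes "2 \<le> r" "r \<le> n" "finite I" "\<And>i. i \<in> I \<Longrightarrow> a i \<le> n"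
  shows "(\<Sum>i\<in>I. a i choose r) \<le> packed n r (\<Sum>i\<in>I. a i)"
    and "(\<Sum>i\<in>I. a i choose r) = packed n r (\<Sum>i\<in>I. a i) \<Longrightarrow>
      card {i \<in> I. a i = n} = (\<Sum>i\<in>I. a i) div n"
proof -
  have "(\<Sum>i\<in>I. a i choose r) \<le> packed n r (\<Sum>i\<in>I. a i) \<and>
    ((\<Sum>i\<in>I. a i choose r) = packed n r (\<Sum>i\<in>I. a i) \<longrightarrow>
      card {i \<in> I. a i = n} = (\<Sum>i\<in>I. a i) div n)"
    using assms(3,4)
  proof (induction I rule: finite_induct)
    case (insert j I)
    define s where "s = (\<Sum>i\<in>I. a i)"
    have j: "a j \<le> n" using insert by simp
    have IH: "(\<Sum>i\<in>I. a i choose r) \<le> packed n r s"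
      "(\<Sum>i\<in>I. a i choose r) = packed n r s \<Longrightarrow> card {i \<in> I. a i = n} = s div n"
      using insert by (simp_all add: s_def)
    note P = packed_add[OF assms(1,2) j, of s]
    have sums: "(\<Sum>i\<in>insert j I. a i) = a j + s"
      "(\<Sum>i\<in>insert j I. a i choose r) = (a j choose r) + (\<Sum>i\<in>I. a i choose r)"
      using insert by (simp_all add: s_def)
    have "card {i \<in> insert j I. a i = n} = (a j + s) div n"
      if eq: "(a j choose r) + (\<Sum>i\<in>I. a i choose r) = packed n r (a j + s)"
    proof -
      have full: "card {i \<in> I. a i = n} = s div n" and
        step: "(a j choose r) + packed n r s = packed n r (a j + s)"
        using eq IH P(1) by linarith+
      show ?thesis
      proof (cases "a j = n")
        case True
        have "{i \<in> insert j I. a i = n} = insert j {i \<in> I. a i = n}" using True by auto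
        then show ?thesis using True full insert(1,2) assms(1,2) by (simp add: div_add_self1)
      next
        case False
        then have "{i \<in> insert j I. a i = n} = {i \<in> I. a i = n}" by auto
        then show ?thesis using P(2)[OF step] False j full by simp
      qed
    qed
    then show ?case unfolding sums using IH(1) P(1) by linarith
  qed (simp add: packed_def)
  then show "(\<Sum>i\<in>I. a i choose r) \<le> packed n r (\<Sum>i\<in>I. a i)"
    "(\<Sum>i\<in>I. a i choose r) = packed n r (\<Sum>i\<in>I. a i) \<Longrightarrow>
      card {i \<in> I. a i = n} = (\<Sum>i\<in>I. a i) div n"
    by blast+
qed

section \<open>Convexity of the minimal cost of one color\<close>

text \<open>By \<open>packed_sum\<close>, a lower bound for the number of monochromatic edges in a
  color with \<open>s\<close> vertices. Integer values keep differences from being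
  truncated.\<close>

definition excess :: "nat \<Rightarrow> nat \<Rightarrow> nat \<Rightarrow> int" where
  "excess n r s = int (s choose r) - int (packed n r s)"

text \<open>The forward difference of \<open>excess\<close>, as \<open>excess_Suc\<close>
  shows.\<close>

definition marginal :: "nat \<Rightarrow> nat \<Rightarrow> nat \<Rightarrow> int" where
  "marginal n r s = int (s choose (r - 1)) - int (s mod n choose (r - 1))"

text \<open>Pascal's rule applies to both binomial terms. When the remainder wraps from
  \<open>n - 1\<close> to 0, the completed part contributes \<open>n choose r\<close>, and Pascal's
  rule gives the same increment.\<close>

lemma excess_Suc:
  assumes "1 \<le> r" "0 < n"
  shows "excess n r (Suc s) = excess n r s + marginal n r s"
proof -
  obtain q where r: "r = Suc q" using assms(1) by (cases r) auto
  show ?thesis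
  proof (cases "Suc (s mod n) = n")
    case True
    then have "Suc s div n = Suc (s div n)" "Suc s mod n = 0"
      by (simp_all add: div_Suc mod_Suc)
    moreover have "n choose r = (s mod n choose q) + (s mod n choose r)"
      using True r by (metis binomial_Suc_Suc)
    ultimately show ?thesis by (simp add: excess_def marginal_def packed_def r)
  next
    case False
    then have "Suc s div n = s div n" "Suc s mod n = Suc (s mod n)"
      by (simp_all add: div_Suc mod_Suc)
    then show ?thesis by (simp add: excess_def marginal_def packed_def r)
  qed
qed

text \<open>If the remainder wraps to 0, the subtracted term drops from a positive value to 0.
  Otherwise the increment is \<open>s choose (r - 2)\<close> minus
  \<open>s mod n choose (r - 2)\<close>, which is positive as soon as
  \<open>s \<ge> n\<close>.\<close>

lemma marginal_Suc:
  assumes "3 \<le> r" "r \<le> n"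
  shows "marginal n r s \<le> marginal n r (Suc s)"
    and "n \<le> Suc s \<Longrightarrow> marginal n r s < marginal n r (Suc s)"
proof -
  obtain q where q: "r - 1 = Suc q" "1 \<le> q" "r = q + 2"
    using assms(1) by (metis add_2_eq_Suc' diff_Suc_1 le_add_diff_inverse2 One_nat_def
        Suc_le_mono numeral_3_eq_3 Suc_le_D)
  have *: "marginal n r s \<le> marginal n r (Suc s) \<and>
      (n \<le> Suc s \<longrightarrow> marginal n r s < marginal n r (Suc s))"
  proof (cases "Suc (s mod n) = n")
    case True
    then have "Suc s mod n = 0" by (simp add: mod_Suc)
    moreover have "s mod n choose Suc q > 0" using True assms q by simp
    ultimately show ?thesis unfolding marginal_def q(1) by (simp del: zero_less_binomial_iff)
  next
    case False
    then have m: "Suc s mod n = Suc (s mod n)" by (simp add: mod_Suc)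
    have le: "s mod n choose q \<le> s choose q" by (intro binomial_right_mono) simp
    have "s mod n choose q < s choose q" if "n \<le> Suc s"
    proof -
      \<comment> \<open>At \<open>s = n - 1\<close> the remainder would wrap, so
        \<open>n \<le> s\<close>, and \<open>s\<close> exceeds its remainder.\<close>
      have "s \<noteq> n - 1" using False assms by auto
      then have "n \<le> s" using that by simp
      moreover have "s mod n < n" using assms by simp
      ultimately show ?thesis using q(2,3) assms(2) by (intro choose_strict_mono) linarith+
    qed
    then show ?thesis using le by (auto simp: marginal_def m q)
  qed
  show "marginal n r s \<le> marginal n r (Suc s)" using * by blast
  show "n \<le> Suc s \<Longrightarrow> marginal n r s < marginal n r (Suc s)" using * by blast
qed

text \<open>The line through the points of \<open>f\<close> at \<open>t\<close> and
  \<open>t + 1\<close> has slope \<open>d t\<close>. Induction runs leftwards from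
  \<open>t - 1\<close> and rightwards from \<open>t + 2\<close>; one strict step next to the contact
  points suffices on each side.\<close>

lemma discrete_supporting_line:
  fixes f d :: "nat \<Rightarrow> int"
  assumes step: "\<And>s. f (Suc s) = f s + d s"
    and mono: "\<And>s. d s \<le> d (Suc s)"
    and strict: "\<And>s. t \<le> Suc s \<Longrightarrow> d s < d (Suc s)"
    and s: "s \<noteq> t" "s \<noteq> Suc t"
  shows "f t + (int s - int t) * d t < f s"
proof (cases "s < t")
  case True
  then obtain u where u: "t = Suc u" by (cases t) auto
  have "s \<le> u" using True u by simp
  then have "f t + (int s - int t) * d t < f s"
  proof (induction s rule: inc_induct)
    case base
    have "d u < d t" using strict[of u] u by simp
    then show ?case using step[of u] by (simp add: u)
  next
    case (step v)
    have "d v \<le> d t" using lift_Suc_mono_le[of d v t] mono step(2) u by simp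
    then show ?case using step(3) assms(1)[of v] by (simp add: algebra_simps)
  qed
  then show ?thesis .
next
  case False
  then have "Suc (Suc t) \<le> s" using s by simp
  then show ?thesis
  proof (induction s rule: dec_induct)
    case base
    have "d t < d (Suc t)" using strict[of t] by simp
    then show ?case using step[of t] step[of "Suc t"] by simp
  next
    case (step v)
    have "d t \<le> d v" using lift_Suc_mono_le[of d t v] mono step(1) by simp
    then show ?case using step(3) assms(1)[of v] by (simp add: algebra_simps)
  qed
qed

section \<open>Counting monochromatic edges\<close>

definition total :: "nat \<Rightarrow> nat \<Rightarrow> coloring \<Rightarrow> color \<Rightarrow> nat" where
  "total k n c x = (\<Sum>i<k. color_count n c i x)"

lemma finite_vclass [simp]: "finite (vclass n i)"
  by (simp add: vclass_def)

lemma color_count_sum: "(\<Sum>x\<in>UNIV. color_count n c i x) = n"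
proof -
  have "(\<Sum>x\<in>UNIV. color_count n c i x) = card (\<Union>x\<in>UNIV. {v \<in> vclass n i. c v = x})"
    unfolding color_count_def by (subst card_UN_disjoint) (auto simp: finite_UNIV_color)
  also have "(\<Union>x\<in>UNIV. {v \<in> vclass n i. c v = x}) = vclass n i" by auto
  finally show ?thesis by (simp add: vclass_def)
qed

lemma color_count_le: "color_count n c i x \<le> n"
  using color_count_sum[of n c i] member_le_sum[of x UNIV "color_count n c i"] finite_UNIV_color
  by simp

lemma total_sum: "(\<Sum>x\<in>UNIV. total k n c x) = k * n"
  unfolding total_def by (subst sum.swap) (simp add: color_count_sum)

lemma color_count_full:
  assumes "color_count n c i x = n" "y \<noteq> x"
  shows "color_count n c i y = 0"
  using color_count_sum[of n c i] assms
  by (cases x; cases y) (auto simp: UNIV_color)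

text \<open>The \<open>r\<close>-subsets of the vertices of one color are the monochromatic edges of
  that color together with the \<open>r\<close>-subsets inside a single class.\<close>

lemma num_mono_eq:
  assumes "1 \<le> r"
  shows "num_mono k n r c + (\<Sum>x\<in>UNIV. \<Sum>i<k. color_count n c i x choose r)
       = (\<Sum>x\<in>UNIV. total k n c x choose r)"
proof -
  define W where "W x = {v \<in> vertices k n. c v = x}" for x
  define A where "A i x = {v \<in> vclass n i. c v = x}" for i x
  define sub where "sub S = {e. e \<subseteq> S \<and> card e = r}" for S :: "(nat \<times> nat) set"
  define M where "M x = {e \<in> hedges k n r. \<forall>v\<in>e. c v = x}" for x
  have finA: "finite (A i x)" for i x by (simp add: A_def)
  have WA: "W x = (\<Union>i<k. A i x)" for x by (auto simp: W_def A_def vertices_def)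
  have finW: "finite (W x)" for x unfolding WA using finA by blast
  have fin_sub: "finite (sub S)" if "finite S" for S
    using that by (auto simp: sub_def intro: finite_subset[of _ "Pow S"])
  \<comment> \<open>A nonempty set lies in at most one class and has at most one color; this makes
    the unions below disjoint.\<close>
  have ne: "e \<noteq> {}" if "card e = r" for e :: "(nat \<times> nat) set" using that assms by auto
  have disjA: "A i x \<inter> A j x = {}" if "i \<noteq> j" for i j x
    using that by (auto simp: A_def vclass_def)
  have cardW: "card (W x) = total k n c x" for x
    unfolding WA total_def color_count_def A_def[symmetric]
    by (rule card_UN_disjoint) (use finA disjA in auto)
  have split: "sub (W x) = M x \<union> (\<Union>i<k. sub (A i x))" for x
    by (auto simp: sub_def M_def W_def A_def hedges_def vertices_def)
  have disj1: "M x \<inter> (\<Union>i<k. sub (A i x)) = {}" for x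
    by (auto simp: sub_def M_def A_def hedges_def)
  have finM: "finite (M x)" for x using split fin_sub[OF finW] by (metis finite_Un)
  have disj2: "sub (A i x) \<inter> sub (A j x) = {}" if "i \<noteq> j" for i j x
    using disjA[OF that, of x] ne unfolding sub_def by blast
  have card_sub: "card (sub S) = card S choose r" if "finite S" for S
    unfolding sub_def using n_subsets[OF that] .
  have "card (sub (W x)) = card (M x) + card (\<Union>i<k. sub (A i x))" for x
    unfolding split by (rule card_Un_disjoint) (use finM finA fin_sub disj1 in auto)
  moreover have "card (\<Union>i<k. sub (A i x)) = (\<Sum>i<k. card (sub (A i x)))" for x
    by (rule card_UN_disjoint) (use finA fin_sub disj2 in auto)
  ultimately have eq: "total k n c x choose r
      = card (M x) + (\<Sum>i<k. color_count n c i x choose r)" for x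
    using card_sub finW finA cardW by (simp add: color_count_def A_def)
  have "{e \<in> hedges k n r. monochromatic c e} = (\<Union>x\<in>UNIV. M x)"
    by (auto simp: M_def monochromatic_def)
  moreover have "M x \<inter> M y = {}" if "x \<noteq> y" for x y
    using that ne by (fastforce simp: M_def hedges_def)
  ultimately have "num_mono k n r c = (\<Sum>x\<in>UNIV. card (M x))"
    unfolding num_mono_def by (simp add: card_UN_disjoint finite_UNIV_color finM)
  then show ?thesis by (simp add: eq sum.distrib)
qed

section \<open>Optimal colorings\<close>

text \<open>The equality case of the lower bound: the totals are balanced, and each color fills as
  many classes as its total permits. It links minimality with uniqueness.\<close>

definition optimal :: "nat \<Rightarrow> nat \<Rightarrow> coloring \<Rightarrow> bool" where
  "optimal k n c \<longleftrightarrow> (\<forall>x. total k n c x \<in> {k * n div 3, Suc (k * n div 3)} \<and>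
     card {i. i < k \<and> color_count n c i x = n} = total k n c x div n)"

text \<open>The supporting line of \<open>excess\<close> at \<open>k * n div 3\<close>, summed over
  three color totals that add up to \<open>k * n\<close>.\<close>

definition mono_bound :: "nat \<Rightarrow> nat \<Rightarrow> nat \<Rightarrow> int" where
  "mono_bound k n r = 3 * excess n r (k * n div 3)
     + (int (k * n) - 3 * int (k * n div 3)) * marginal n r (k * n div 3)"

lemma sum_color_count_packed:
  assumes "2 \<le> r" "r \<le> n"
  shows "(\<Sum>i<k. color_count n c i x choose r) \<le> packed n r (total k n c x)"
    and "(\<Sum>i<k. color_count n c i x choose r) = packed n r (total k n c x) \<Longrightarrow>
      card {i. i < k \<and> color_count n c i x = n} = total k n c x div n"
  using packed_sum[OF assms, of "{..<k}" "\<lambda>i. color_count n c i x"] color_count_le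
  by (simp_all add: total_def)

text \<open>Separates the cost of the color totals from the loss caused by imperfect packing, so
  that each can be bounded on its own.\<close>

lemma num_mono_excess:
  assumes "1 \<le> r"
  shows "int (num_mono k n r c) = (\<Sum>x\<in>UNIV. excess n r (total k n c x))
    + (\<Sum>x\<in>UNIV. int (packed n r (total k n c x)) - int (\<Sum>i<k. color_count n c i x choose r))"
proof -
  have "int (num_mono k n r c) = (\<Sum>x\<in>UNIV. int (total k n c x choose r))
    - (\<Sum>x\<in>UNIV. int (\<Sum>i<k. color_count n c i x choose r))"
    using arg_cong[OF num_mono_eq[OF assms, of k n c], of int] by simp
  then show ?thesis by (simp add: excess_def sum_subtractf)
qed

text \<open>Since \<open>n \<le> t\<close>, \<open>marginal\<close> increases strictly from
  \<open>t - 1\<close> on, so the line touches only at \<open>t\<close> and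
  \<open>t + 1\<close>.\<close>

lemma excess_supporting_line:
  assumes "3 \<le> r" "r \<le> n" "n \<le> t"
  shows "excess n r t + (int s - int t) * marginal n r t \<le> excess n r s"
    and "excess n r t + (int s - int t) * marginal n r t = excess n r s \<longleftrightarrow> s \<in> {t, Suc t}"
proof -
  have "excess n r t + (int s - int t) * marginal n r t < excess n r s" if "s \<noteq> t" "s \<noteq> Suc t"
    using that assms
    by (intro discrete_supporting_line[where d = "marginal n r"] excess_Suc marginal_Suc) auto
  moreover have "excess n r t + (int s - int t) * marginal n r t = excess n r s"
    if "s = t \<or> s = Suc t"
    using that excess_Suc[of r n t] assms by auto
  ultimately show "excess n r t + (int s - int t) * marginal n r t \<le> excess n r s"
    "excess n r t + (int s - int t) * marginal n r t = excess n r s \<longleftrightarrow> s \<in> {t, Suc t}"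
    by (smt (verit) insert_iff singleton_iff)+
qed

lemma sum_color_eq_iff:
  fixes f g :: "color \<Rightarrow> int"
  assumes "\<And>x. f x \<le> g x"
  shows "sum f UNIV = sum g UNIV \<longleftrightarrow> (\<forall>x. f x = g x)"
  using sum_mono_inv[of f UNIV g] assms finite_UNIV_color by auto

text \<open>For each color, the line value \<open>L x\<close> is at most the excess, and the packing
  loss \<open>D x\<close> is nonnegative. Equality of the sums therefore forces both equalities for
  every color.\<close>

lemma num_mono_bound:
  assumes "3 \<le> r" "r \<le> n" "3 \<le> k"
  shows "mono_bound k n r \<le> int (num_mono k n r c)"
    and "int (num_mono k n r c) = mono_bound k n r \<Longrightarrow> optimal k n c"
proof -
  define t where "t = k * n div 3"
  define S where "S = total k n c"
  have t: "n \<le> t" using div_le_mono[OF mult_le_mono1[OF assms(3), of n], of 3] by (simp add: t_def)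
  have r: "1 \<le> r" "2 \<le> r" using assms by auto
  define D where "D x = int (packed n r (S x)) - int (\<Sum>i<k. color_count n c i x choose r)" for x
  define L where "L x = excess n r t + (int (S x) - int t) * marginal n r t" for x
  have D: "D x \<ge> 0" for x using sum_color_count_packed(1)[OF r(2) assms(2)]
    by (simp add: D_def S_def del: of_nat_sum)
  have L: "L x \<le> excess n r (S x)" for x
    unfolding L_def using excess_supporting_line(1)[OF assms(1,2) t] .
  \<comment> \<open>\<open>L\<close> is affine in \<open>S x\<close>, so its sum depends only on the
    sum of the totals, not on the coloring.\<close>
  have "sum L UNIV = 3 * excess n r t + (int (\<Sum>x\<in>UNIV. S x) - 3 * int t) * marginal n r t"
    by (simp add: L_def UNIV_color algebra_simps)
  then have bound: "sum L UNIV = mono_bound k n r"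
    unfolding S_def total_sum by (simp add: mono_bound_def t_def)
  have N: "int (num_mono k n r c) = (\<Sum>x\<in>UNIV. excess n r (S x) + D x)"
    unfolding num_mono_excess[OF r(1)] by (simp add: S_def D_def sum.distrib)
  have LD: "L x \<le> excess n r (S x) + D x" for x using L[of x] D[of x] by simp
  show "mono_bound k n r \<le> int (num_mono k n r c)"
    unfolding N bound[symmetric] by (rule sum_mono) (rule LD)
  assume "int (num_mono k n r c) = mono_bound k n r"
  then have "\<forall>x. L x = excess n r (S x) + D x"
    using sum_color_eq_iff[of L "\<lambda>x. excess n r (S x) + D x"] LD N bound by simp
  then have "L x = excess n r (S x) \<and> D x = 0" for x
    using L[of x] D[of x] by (smt (verit))
  then show "optimal k n c"
    unfolding optimal_def
    using excess_supporting_line(2)[OF assms(1,2) t] sum_color_count_packed(2)[OF r(2) assms(2)]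
    by (auto simp: L_def D_def S_def t_def simp del: of_nat_sum)
qed

section \<open>Structure of optimal colorings\<close>

definition partial_classes :: "nat \<Rightarrow> nat \<Rightarrow> coloring \<Rightarrow> nat set" where
  "partial_classes k n c = {i. i < k \<and> (\<forall>x. color_count n c i x \<noteq> n)}"

text \<open>A class is full in \<open>x\<close>, full in another color and then contributes
  \<open>h 0 = 0\<close>, or partial. Used with \<open>h\<close> the identity and with
  \<open>h\<close> the binomial coefficient.\<close>

lemma sum_color_count_split:
  fixes h :: "nat \<Rightarrow> nat"
  assumes "0 < n" "h 0 = 0"
  shows "(\<Sum>i<k. h (color_count n c i x)) = card {i. i < k \<and> color_count n c i x = n} * h n
    + (\<Sum>i\<in>partial_classes k n c. h (color_count n c i x))"
proof -
  define F where "F = {i. i < k \<and> color_count n c i x = n}"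
  define E where "E = partial_classes k n c"
  have sub: "F \<subseteq> {..<k}" "E \<subseteq> {..<k}" by (auto simp: F_def E_def partial_classes_def)
  have "F \<inter> E = {}" by (auto simp: F_def E_def partial_classes_def)
  moreover have "h (color_count n c i x) = 0" if "i \<in> {..<k} - (F \<union> E)" for i
  proof -
    have "\<exists>y. color_count n c i y = n"
      using that by (auto simp: E_def partial_classes_def)
    then obtain y where y: "color_count n c i y = n" ..
    then have "y \<noteq> x" using that by (auto simp: F_def)
    then show ?thesis using y color_count_full assms(2) by metis
  qed
  ultimately have "(\<Sum>i<k. h (color_count n c i x))
      = (\<Sum>i\<in>F. h (color_count n c i x)) + (\<Sum>i\<in>E. h (color_count n c i x))"
    using sub finite_subset[OF sub(1)] finite_subset[OF sub(2)]
    by (subst sum.union_disjoint[symmetric]) (auto intro!: sum.mono_neutral_right)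
  moreover have "(\<Sum>i\<in>F. h (color_count n c i x)) = card F * h n" by (simp add: F_def)
  ultimately show ?thesis by (simp add: F_def E_def)
qed

text \<open>With \<open>k = 3 * m + d\<close> and \<open>d \<le> 1\<close>, a balanced total is
  \<open>m * n + e\<close> with \<open>e \<le> d * n div 3 + 1\<close>, which is below
  \<open>n\<close> because \<open>n \<ge> 3\<close>.\<close>

lemma optimal_card_full:
  assumes "3 \<le> n" "k mod 3 \<noteq> 2" "optimal k n c"
  shows "total k n c x div n = k div 3"
    and "card {i. i < k \<and> color_count n c i x = n} = k div 3"
proof -
  define m where "m = k div 3"
  obtain d where d: "k = 3 * m + d" "d \<le> 1"
    using that[of "k mod 3"] assms(2) by (auto simp: m_def)
  have "k * n = 3 * (m * n) + d * n" by (simp add: d algebra_simps)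
  then have t: "k * n div 3 = m * n + d * n div 3" by simp
  have "d * n div 3 + 1 < n" using d(2) assms(1) by (cases d) auto
  moreover have S: "total k n c x \<in> {k * n div 3, Suc (k * n div 3)}"
    and F: "card {i. i < k \<and> color_count n c i x = n} = total k n c x div n"
    using assms(3) by (auto simp: optimal_def)
  ultimately obtain e where "total k n c x = m * n + e" "e < n"
    using t by (metis add_Suc_right insertE Suc_eq_plus1 add_lessD1 singletonD)
  then show "total k n c x div n = k div 3" by (simp add: m_def)
  then show "card {i. i < k \<and> color_count n c i x = n} = k div 3" using F by simp
qed

text \<open>As \<open>n > 0\<close>, no class is full in two colors, so the full classes form three
  disjoint sets of size \<open>m\<close>.\<close>

lemma card_partial_classes:
  assumes "0 < n" "\<And>x. card {i. i < k \<and> color_count n c i x = n} = m"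
  shows "card (partial_classes k n c) = k - 3 * m"
proof -
  define F where "F x = {i. i < k \<and> color_count n c i x = n}" for x
  have "F x \<inter> F y = {}" if "x \<noteq> y" for x y
    using color_count_full[OF _ that] assms(1) by (fastforce simp: F_def)
  then have "card (\<Union>x\<in>UNIV. F x) = 3 * m"
    using assms(2) by (subst card_UN_disjoint) (auto simp: F_def finite_UNIV_color UNIV_color)
  moreover have "partial_classes k n c = {..<k} - (\<Union>x\<in>UNIV. F x)" "(\<Union>x\<in>UNIV. F x) \<subseteq> {..<k}"
    by (auto simp: partial_classes_def F_def)
  ultimately show ?thesis by (simp add: card_Diff_subset finite_subset)
qed

lemma optimal_partial_classes:
  assumes "3 \<le> n" "k mod 3 \<noteq> 2" "optimal k n c"
  shows "partial_classes k n c = {} \<or> (\<exists>i. partial_classes k n c = {i})"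
proof -
  have "card (partial_classes k n c) = k - 3 * (k div 3)"
    using optimal_card_full(2)[OF assms] assms(1) by (intro card_partial_classes) auto
  then have "card (partial_classes k n c) \<le> 1" using assms(2) by presburger
  moreover have "finite (partial_classes k n c)" by (simp add: partial_classes_def)
  ultimately show ?thesis by (metis card_0_eq card_1_singletonE le_antisym less_one linorder_not_le)
qed

text \<open>At most one class is partial, so it holds exactly the remainder of each total and the
  packing loss is zero. The balanced totals lie on the supporting line.\<close>

lemma optimal_num_mono:
  assumes "3 \<le> r" "r \<le> n" "3 \<le> k" "k mod 3 \<noteq> 2" "optimal k n c"
  shows "int (num_mono k n r c) = mono_bound k n r"
proof -
  define t where "t = k * n div 3"
  define S where "S = total k n c"
  define m where "m = k div 3"
  have n: "3 \<le> n" "0 < n" using assms by auto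
  have t: "n \<le> t" using div_le_mono[OF mult_le_mono1[OF assms(3), of n], of 3] by (simp add: t_def)
  have packed: "(\<Sum>i<k. color_count n c i x choose r) = packed n r (S x)" for x
  proof -
    have S: "S x = m * n + (\<Sum>i\<in>partial_classes k n c. color_count n c i x)"
      using sum_color_count_split[OF n(2), of "\<lambda>a. a" c x k]
        optimal_card_full(2)[OF n(1) assms(4,5)]
      by (simp add: S_def total_def m_def)
    have C: "(\<Sum>i<k. color_count n c i x choose r)
        = m * (n choose r) + (\<Sum>i\<in>partial_classes k n c. color_count n c i x choose r)"
      using sum_color_count_split[OF n(2), of "\<lambda>a. a choose r" c x k] assms(1)
        optimal_card_full(2)[OF n(1) assms(4,5)]
      by (simp add: m_def binomial_eq_0)
    from optimal_partial_classes[OF n(1) assms(4,5)] show ?thesis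
    proof (elim disjE exE)
      assume "partial_classes k n c = {}"
      then show ?thesis using S C n assms(1) by (simp add: packed_def binomial_eq_0)
    next
      fix i assume i: "partial_classes k n c = {i}"
      then have "color_count n c i x < n"
        using color_count_le[of n c i x] by (auto simp: partial_classes_def le_less)
      then show ?thesis using S C i n by (simp add: packed_def)
    qed
  qed
  have "int (num_mono k n r c) = (\<Sum>x\<in>UNIV. excess n r (S x))"
    using num_mono_excess[of r k n c] assms(1) packed by (simp add: S_def del: of_nat_sum)
  also have "\<dots> = (\<Sum>x\<in>UNIV. excess n r t + (int (S x) - int t) * marginal n r t)"
  proof (rule sum.cong)
    fix x
    have "S x \<in> {t, Suc t}" using assms(5) by (simp add: optimal_def S_def t_def)
    then show "excess n r (S x) = excess n r t + (int (S x) - int t) * marginal n r t"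
      using excess_supporting_line(2)[OF assms(1,2) t] by metis
  qed simp
  also have "\<dots> = 3 * excess n r t + (int (\<Sum>x\<in>UNIV. S x) - 3 * int t) * marginal n r t"
    by (simp add: UNIV_color algebra_simps)
  also have "\<dots> = mono_bound k n r"
    unfolding S_def total_sum by (simp add: mono_bound_def t_def)
  finally show ?thesis .
qed

section \<open>Uniqueness\<close>

text \<open>Equal fiber sizes mean equal image multisets. This produces both the color permutation
  and the class permutation.\<close>

lemma permutes_of_card_fibers:
  assumes "finite A" "\<And>b. card {a \<in> A. f a = b} = card {a \<in> A. g a = b}"
  obtains p where "p permutes A" "\<forall>a\<in>A. f a = g (p a)"
proof -
  have "image_mset f (mset_set A) = image_mset g (mset_set A)"
    using assms by (intro multiset_eqI) (simp add: count_image_mset_eq_card_vimage)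
  then show ?thesis using image_mset_eq_implies_permutes[OF assms(1)] that by metis
qed

text \<open>Exactly \<open>sum f UNIV - 3 * t\<close> of the three values are \<open>t + 1\<close>,
  so the sum alone fixes the multiset of values.\<close>

lemma card_color_fibers:
  fixes f :: "color \<Rightarrow> nat"
  assumes "\<And>x. f x \<in> {t, Suc t}"
  shows "card {x \<in> UNIV. f x = b} =
    (if b = Suc t then sum f UNIV - 3 * t else if b = t then 3 - (sum f UNIV - 3 * t) else 0)"
proof -
  have "sum f UNIV = (\<Sum>x\<in>UNIV. t + (if f x = Suc t then 1 else 0))"
    using assms by (intro sum.cong) force+
  also have "\<dots> = 3 * t + card {x. f x = Suc t}"
    using finite_UNIV_color by (simp add: sum.distrib sum.If_cases) (simp add: UNIV_color)
  finally have *: "card {x. f x = Suc t} = sum f UNIV - 3 * t" by simp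
  have "{x. f x = t} = UNIV - {x. f x = Suc t}" using assms by force
  then have **: "card {x. f x = t} = 3 - card {x. f x = Suc t}"
    using finite_subset[OF subset_UNIV finite_UNIV_color]
    by (simp add: card_Diff_subset) (simp add: UNIV_color)
  have "b \<noteq> t \<Longrightarrow> b \<noteq> Suc t \<Longrightarrow> {x. f x = b} = {}" using assms by force
  then show ?thesis using * ** by auto
qed

text \<open>Each class is labelled by the set of colors that fill it, read through
  \<open>\<pi>\<close>. The label is empty or a singleton, and the fiber sizes depend only on
  \<open>k\<close> and \<open>m\<close>, so they agree for any two such colorings.\<close>

lemma card_full_color_fibers:
  assumes "0 < n" "bij \<pi>" "\<And>x. card {i. i < k \<and> color_count n c i x = n} = m"
  shows "card {i \<in> {..<k}. {x. color_count n c i (\<pi> x) = n} = b} =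
    (if b = {} then k - 3 * m else if is_singleton b then m else 0)"
proof -
  have uniq: "\<pi> x = \<pi> y" if "color_count n c i (\<pi> x) = n" "color_count n c i (\<pi> y) = n" for i x y
    using color_count_full[OF that(1), of "\<pi> y"] that(2) assms(1) by (cases "\<pi> x = \<pi> y") auto
  then have eq: "x = y" if "color_count n c i (\<pi> x) = n" "color_count n c i (\<pi> y) = n" for i x y
    using that assms(2) by (meson bij_is_inj injD)
  consider "b = {}" | x where "b = {x}" | "b \<noteq> {}" "\<not> is_singleton b"
    by (metis is_singletonE)
  then show ?thesis
  proof cases
    case 1
    have "{i \<in> {..<k}. {x. color_count n c i (\<pi> x) = n} = {}} = partial_classes k n c"
      using assms(2) by (auto simp: partial_classes_def) (metis bij_pointE)
    then show ?thesis using 1 card_partial_classes[OF assms(1,3)] by simp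
  next
    case 2
    have "{i \<in> {..<k}. {y. color_count n c i (\<pi> y) = n} = {x}}
        = {i. i < k \<and> color_count n c i (\<pi> x) = n}"
      using eq by blast
    then show ?thesis using 2 assms(3) by simp
  next
    case 3
    have "{i \<in> {..<k}. {x. color_count n c i (\<pi> x) = n} = b} = {}"
      using eq 3 by (auto simp: is_singleton_def) blast
    then show ?thesis using 3 by simp
  qed
qed

text \<open>First \<open>\<pi>\<close> matches the color totals, then \<open>\<sigma>\<close>
  matches the labels of the classes. A label determines the counts of a full class, and the totals
  determine those of the partial class.\<close>

lemma optimal_same_up_to_perm:
  assumes "3 \<le> n" "k mod 3 \<noteq> 2" "optimal k n c" "optimal k n c'"
  shows "same_up_to_perm k n c c'"
proof -
  note full = optimal_card_full(2)[OF assms(1,2)]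
  have n: "0 < n" using assms by simp
  have S: "total k n c x \<in> {k * n div 3, Suc (k * n div 3)}"
    "total k n c' x \<in> {k * n div 3, Suc (k * n div 3)}" for x
    using assms(3,4) by (auto simp: optimal_def)
  have fibers: "card {x \<in> UNIV. total k n c x = b} = card {x \<in> UNIV. total k n c' x = b}" for b
    using card_color_fibers[where f = "total k n c" and b = b, OF S(1)]
      card_color_fibers[where f = "total k n c'" and b = b, OF S(2)]
    by (simp only: total_sum)
  obtain \<pi> where \<pi>: "\<pi> permutes UNIV" "\<forall>x\<in>UNIV. total k n c x = total k n c' (\<pi> x)"
    by (rule permutes_of_card_fibers[OF finite_UNIV_color fibers])
  have bij: "bij \<pi>" using \<pi>(1) by (rule permutes_bij)
  define L where "L i = {x. color_count n c i x = n}" for i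
  define L' where "L' i = {x. color_count n c' i (\<pi> x) = n}" for i
  have labels: "card {i \<in> {..<k}. L i = b} = card {i \<in> {..<k}. L' i = b}" for b
    using card_full_color_fibers[OF n bij_id full[OF assms(3)], of b]
      card_full_color_fibers[OF n bij full[OF assms(4)], of b]
    by (simp add: L_def L'_def)
  obtain \<sigma> where \<sigma>: "\<sigma> permutes {..<k}" "\<forall>i\<in>{..<k}. L i = L' (\<sigma> i)"
    by (rule permutes_of_card_fibers[OF finite_lessThan labels])
  \<comment> \<open>The partial class receives what the \<open>k div 3\<close> full classes leave of
    each total, hence \<open>\<pi>\<close> matches its counts too.\<close>
  have part: "total k n c'' x = (k div 3) * n + color_count n c'' i x"
    if "i \<in> partial_classes k n c''" "optimal k n c''" for i x c''
  proof -
    have "partial_classes k n c'' = {i}"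
      using optimal_partial_classes[OF assms(1,2) that(2)] that(1) by auto
    then show ?thesis
      using sum_color_count_split[OF n, of "\<lambda>a. a" c'' x k] full[OF that(2)]
      by (simp add: total_def)
  qed
  have "color_count n c' (\<sigma> i) (\<pi> x) = color_count n c i x" if i: "i < k" for i x
  proof -
    have Li: "L i = L' (\<sigma> i)" using \<sigma>(2) i by simp
    show ?thesis
    proof (cases "L i = {}")
      case True
      then have "i \<in> partial_classes k n c" using i by (auto simp: partial_classes_def L_def)
      moreover have "\<sigma> i \<in> partial_classes k n c'"
      proof -
        have "L' (\<sigma> i) = {}" using True Li by simp
        then have "color_count n c' (\<sigma> i) (\<pi> y) \<noteq> n" for y by (simp add: L'_def)
        then have "color_count n c' (\<sigma> i) y \<noteq> n" for y
          using surjD[OF bij_is_surj[OF bij], of y] by blast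
        moreover have "\<sigma> i < k" using i permutes_in_image[OF \<sigma>(1), of i] by simp
        ultimately show ?thesis by (simp add: partial_classes_def)
      qed
      ultimately show ?thesis using part assms(3,4) \<pi>(2) by (metis UNIV_I add_left_cancel)
    next
      case False
      then obtain y where "y \<in> L i" by blast
      then have y: "color_count n c i y = n" "color_count n c' (\<sigma> i) (\<pi> y) = n"
        using Li by (auto simp: L_def L'_def)
      show ?thesis
      proof (cases "x = y")
        case False
        then have "\<pi> x \<noteq> \<pi> y" using bij by (meson bij_is_inj injD)
        then show ?thesis using False y color_count_full by metis
      qed (use y in simp)
    qed
  qed
  then show ?thesis
    unfolding same_up_to_perm_def using bij permutes_imp_bij[OF \<sigma>(1)] by blast
qed

section \<open>The block colorings are optimal\<close>

text \<open>The blocks give every color \<open>m\<close> full classes. An equitable last class adds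
  \<open>n div 3\<close> or one more to each total, which is less than \<open>n\<close>, so it is
  full in no color.\<close>

lemma block_colored_optimal:
  assumes "3 \<le> n" "k = 3 * m + d" "d \<le> 1" "block_colored m n c"
    and eq: "d = 1 \<Longrightarrow> equitable_on_class n c (3 * m)"
  shows "optimal k n c"
proof -
  define B where "B x = (case x of Red \<Rightarrow> {..<m} | Blue \<Rightarrow> {m..<2 * m} | Green \<Rightarrow> {2 * m..<3 * m})"
    for x
  have B: "B x \<subseteq> {..<3 * m}" "card (B x) = m" for x by (cases x; auto simp: B_def)+
  have full: "color_count n c i x = n" if "i \<in> B x" for i x
  proof -
    have "{v \<in> vclass n i. c v = x} = vclass n i"
      using that assms(4) by (cases x) (auto simp: B_def block_colored_def)
    then show ?thesis by (simp add: color_count_def vclass_def)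
  qed
  have empty: "color_count n c i x = 0" if "i < 3 * m" "i \<notin> B x" for i x
  proof -
    have "i \<in> B Red \<or> i \<in> B Blue \<or> i \<in> B Green" using that(1) by (auto simp: B_def)
    then obtain y where "i \<in> B y" by blast
    then show ?thesis using that color_count_full[OF full] by metis
  qed
  have "(\<Sum>i<3 * m. color_count n c i x) = (\<Sum>i\<in>B x. n)" for x
    using B(1)[of x] full empty by (intro sum.mono_neutral_cong_right) auto
  then have sum: "(\<Sum>i<3 * m. color_count n c i x) = m * n" for x using B(2) by simp
  show ?thesis
  proof (cases "d = 0")
    case True
    have "{i. i < k \<and> color_count n c i x = n} = B x" for x
      using B(1)[of x] full empty True assms(1,2) by fastforce
    moreover have "total k n c x = m * n" for x using sum True assms(2) by (simp add: total_def)
    ultimately show ?thesis using True assms(1,2) B(2) by (simp add: optimal_def)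
  next
    case False
    then have k: "k = Suc (3 * m)" using assms by simp
    have last: "color_count n c (3 * m) x \<in> {n div 3, Suc (n div 3)}" for x
    proof -
      have le: "color_count n c (3 * m) y \<le> color_count n c (3 * m) z + 1" for y z
        using eq False assms(3) by (auto simp: equitable_on_class_def)
      have sum: "color_count n c (3 * m) Red + color_count n c (3 * m) Blue
          + color_count n c (3 * m) Green = n"
        using color_count_sum[of n c "3 * m"] by (simp add: UNIV_color)
      \<comment> \<open>Replacing the two other counts by this one costs at most 1 each, in either
        direction.\<close>
      have "3 * color_count n c (3 * m) x \<le> n + 2" "n \<le> 3 * color_count n c (3 * m) x + 2"
        using sum le[of x Red] le[of x Blue] le[of x Green] le[of Red x] le[of Blue x] le[of Green x]
        by (cases x; simp)+
      then show ?thesis by auto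
    qed
    have small: "color_count n c (3 * m) x < n" for x using last[of x] assms(1) by auto
    have "{i. i < k \<and> color_count n c i x = n} = B x" for x
      using B(1)[of x] full empty small[of x] assms(1) unfolding k less_Suc_eq by fastforce
    moreover have S: "total k n c x = m * n + color_count n c (3 * m) x" for x
      using sum by (simp add: total_def k)
    moreover have "k * n div 3 = m * n + n div 3"
    proof -
      have "k * n = n + 3 * (m * n)" by (simp add: k)
      then show ?thesis by simp
    qed
    moreover have "(m * n + color_count n c (3 * m) x) div n = m" for x
      using small[of x] assms(1) by simp
    ultimately show ?thesis using last B(2) by (simp add: optimal_def)
  qed
qed

lemma exists_block_colored:
  "\<exists>c. block_colored m n c \<and> equitable_on_class n c (3 * m)"
proof -
  \<comment> \<open>The last class is cut into intervals of lengths \<open>n div 3\<close>,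
    \<open>(n + 1) div 3\<close> and \<open>(n + 2) div 3\<close>, which add up to
    \<open>n\<close>.\<close>
  define c :: coloring where "c = (\<lambda>(i, j).
    if i < m \<or> 3 * m \<le> i \<and> j < n div 3 then Red
    else if i < 2 * m \<or> 3 * m \<le> i \<and> j < n div 3 + (n + 1) div 3 then Blue
    else Green)"
  have "block_colored m n c" by (auto simp: block_colored_def vclass_def c_def)
  moreover have "equitable_on_class n c (3 * m)"
  proof -
    have c: "c (3 * m, j) = (if j < n div 3 then Red
      else if j < n div 3 + (n + 1) div 3 then Blue else Green)" for j
      by (simp add: c_def)
    have thresholds: "n div 3 \<le> n" "n div 3 + (n + 1) div 3 \<le> n" by presburger+
    have "{v \<in> vclass n (3 * m). c v = Red} = {3 * m} \<times> {..<n div 3}"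
      "{v \<in> vclass n (3 * m). c v = Blue} = {3 * m} \<times> {n div 3..<n div 3 + (n + 1) div 3}"
      "{v \<in> vclass n (3 * m). c v = Green} = {3 * m} \<times> {n div 3 + (n + 1) div 3..<n}"
      using thresholds by (auto simp: vclass_def c split: if_splits)
    then have count: "color_count n c (3 * m) Red = n div 3"
      "color_count n c (3 * m) Blue = (n + 1) div 3"
      "color_count n c (3 * m) Green = n - (n div 3 + (n + 1) div 3)"
      by (simp_all add: color_count_def card_cartesian_product)
    have div: "3 * (n div 3) \<le> n" "n < 3 * (n div 3) + 3"
      "3 * ((n + 1) div 3) \<le> n + 1" "n + 1 < 3 * ((n + 1) div 3) + 3"
      by presburger+
    have "color_count n c (3 * m) x \<le> n div 3 + 1 \<and> n div 3 \<le> color_count n c (3 * m) x" for x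
    proof (cases x)
      case Red
      then show ?thesis using count(1) by simp
    next
      case Blue
      then show ?thesis using count div by simp
    next
      case Green
      then show ?thesis using div unfolding Green count by (intro conjI; linarith)
    qed
    then show ?thesis unfolding equitable_on_class_def by (meson add_le_mono1 le_trans)
  qed
  ultimately show ?thesis by blast
qed

section \<open>Minimizers and optimal colorings\<close>

text \<open>Optimal colorings attain \<open>mono_bound\<close>. Once one exists, every minimizer
  attains it as well and is therefore optimal, and optimal colorings agree up to
  permutation.\<close>

lemma unique_minimizerI:
  assumes "3 \<le> r" "r \<le> n" "3 \<le> k" "k mod 3 \<noteq> 2" "\<exists>c. P c" "\<And>c. P c \<Longrightarrow> optimal k n c"
  shows "unique_minimizer k n r P"
proof -
  have minI: "minimizing k n r c" if "optimal k n c" for c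
    unfolding minimizing_def
    using optimal_num_mono[OF assms(1-4) that] num_mono_bound(1)[OF assms(1-3)]
    by (metis of_nat_le_iff)
  have "optimal k n c'" if "minimizing k n r c'" "optimal k n c" for c c'
    using that num_mono_bound[OF assms(1-3), of c'] optimal_num_mono[OF assms(1-4) that(2)]
    unfolding minimizing_def by (metis of_nat_le_iff order_antisym)
  then show ?thesis
    unfolding unique_minimizer_def
    using assms minI optimal_same_up_to_perm by (meson le_trans)
qed

theorem theorem4:
  fixes n r k :: nat
  assumes "n \<ge> r" and "r \<ge> 3" and "k \<ge> 3"
  shows "(k mod 3 = 0 \<longrightarrow>
            unique_minimizer k n r (\<lambda>c. block_colored (k div 3) n c)) \<and>
         (k mod 3 = 1 \<longrightarrow>
            unique_minimizer k n r
              (\<lambda>c. block_colored (k div 3) n c \<and> equitable_on_class n c (k - 1)))"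
proof (intro conjI impI)
  define m where "m = k div 3"
  have n: "3 \<le> n" using assms by simp
  {
    assume "k mod 3 = 0"
    \<comment> \<open>The summand 0 fits the shape \<open>3 * m + d\<close>; with
      \<open>d = 0\<close> the premise about the last class is vacuous.\<close>
    then have k: "k = 3 * m + 0" using m_def by auto
    show "unique_minimizer k n r (\<lambda>c. block_colored (k div 3) n c)"
      using assms \<open>k mod 3 = 0\<close> exists_block_colored[of m n] block_colored_optimal[OF n k]
      by (intro unique_minimizerI) (auto simp flip: m_def)
  next
    assume "k mod 3 = 1"
    then have k: "k = 3 * m + 1" using m_def by presburger
    then have "k - 1 = 3 * m" by simp
    then show "unique_minimizer k n r
        (\<lambda>c. block_colored (k div 3) n c \<and> equitable_on_class n c (k - 1))"
      using assms \<open>k mod 3 = 1\<close> exists_block_colored[of m n] block_colored_optimal[OF n k]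
      by (intro unique_minimizerI) (auto simp flip: m_def)
  }
qed

end
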